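(* Let $T$ be a tribracket with operation $[\ ,\ ,\ ]_T$ and let $X$ be a finite entropic tribracket with operation $[\ ,\ ,\ ]_X$. Let $\mathrm{Hom}(T,X)$ be the set of tribracket homomorphisms $T\to X$. Then the operation $[\ ,\ ,\ ]_H:(\mathrm{Hom}(T,X))^3\to\mathrm{Hom}(T,X)$ defined by \[[f,g,h]_H(t)=[f(t),g(t),h(t)]_X\qquad (t\in T)\] (in particular it takes values in $\mathrm{Hom}(T,X)$) defines an entropic tribracket structure on $\mathrm{Hom}(T,X)$.
   Context: A (horizontal) tribracket is a set $X$ with a ternary operation $X\times X\times X\to X$, $(x,y,z)\mapsto[x,y,z]$, such that: (i) for all $x,y,z\in X$ there are unique elements $a,b,c\in X$ satisfying $[a,x,y]=z$, $[x,b,y]=z$ and $[x,y,c]=z$; (ii) for all $x,y,z,w\in X$, $[y,[x,y,z],[x,y,w]]=[z,[x,y,z],[x,z,w]]=[w,[x,y,w],[x,z,w]]$. The empty set is allowed as a tribracket. A map $f:X\to Y$ between tribrackets is a tribracket homomorphism if $[f(x),f(y),f(z)]=f([x,y,z])$ for all $x,y,z\in X$. A tribracket $X$ is entropic if for all $x,y,z,u,v,w,a,b,c\in X$, $[[x,y,z],[u,v,w],[a,b,c]]=[[x,u,a],[y,v,b],[z,w,c]]$. *)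

theory Defs
  imports "HOL-Library.FuncSet"
begin

locale tribracket =
  fixes X :: "'a set" and br :: "'a \<Rightarrow> 'a \<Rightarrow> 'a \<Rightarrow> 'a"
  assumes closed: "\<lbrakk>x \<in> X; y \<in> X; z \<in> X\<rbrakk> \<Longrightarrow> br x y z \<in> X"
    and unique_left: "\<lbrakk>x \<in> X; y \<in> X; z \<in> X\<rbrakk> \<Longrightarrow> \<exists>!a. a \<in> X \<and> br a x y = z"
    and unique_middle: "\<lbrakk>x \<in> X; y \<in> X; z \<in> X\<rbrakk> \<Longrightarrow> \<exists>!b. b \<in> X \<and> br x b y = z"
    and unique_right: "\<lbrakk>x \<in> X; y \<in> X; z \<in> X\<rbrakk> \<Longrightarrow> \<exists>!c. c \<in> X \<and> br x y c = z"
    and exchange_left: "\<lbrakk>x \<in> X; y \<in> X; z \<in> X; w \<in> X\<rbrakk> \<Longrightarrow>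
      br y (br x y z) (br x y w) = br z (br x y z) (br x z w)"
    and exchange_right: "\<lbrakk>x \<in> X; y \<in> X; z \<in> X; w \<in> X\<rbrakk> \<Longrightarrow>
      br z (br x y z) (br x z w) = br w (br x y w) (br x z w)"

locale entropic_tribracket = tribracket +
  assumes entropic:
    "\<lbrakk>x \<in> X; y \<in> X; z \<in> X; u \<in> X; v \<in> X; w \<in> X; a \<in> X; b \<in> X; c \<in> X\<rbrakk> \<Longrightarrow>
      br (br x y z) (br u v w) (br a b c) = br (br x u a) (br y v b) (br z w c)"

text \<open>
  Homomorphisms are taken in the extensional function space, so that two of them are equal
  as soon as they agree on the carrier of the domain.
\<close>

definition tribracket_hom ::
    "'a set \<Rightarrow> ('a \<Rightarrow> 'a \<Rightarrow> 'a \<Rightarrow> 'a) \<Rightarrow> 'b set \<Rightarrow> ('b \<Rightarrow> 'b \<Rightarrow> 'b \<Rightarrow> 'b) \<Rightarrow> ('a \<Rightarrow> 'b) set"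
  where "tribracket_hom T brT X brX =
    {f \<in> T \<rightarrow>\<^sub>E X. \<forall>x\<in>T. \<forall>y\<in>T. \<forall>z\<in>T. brX (f x) (f y) (f z) = f (brT x y z)}"

definition hom_bracket ::
    "'a set \<Rightarrow> ('b \<Rightarrow> 'b \<Rightarrow> 'b \<Rightarrow> 'b) \<Rightarrow> ('a \<Rightarrow> 'b) \<Rightarrow> ('a \<Rightarrow> 'b) \<Rightarrow> ('a \<Rightarrow> 'b) \<Rightarrow> ('a \<Rightarrow> 'b)"
  where "hom_bracket T brX f g h = (\<lambda>t\<in>T. brX (f t) (g t) (h t))"

end

theory Submission
  imports Defs
begin

text \<open>
  Everything happens pointwise. An identity between brackets in the codomain passes to
  pointwise brackets of homomorphisms, which settles the exchange laws and entropicity of the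
  hom-set; what remains is that pointwise constructions produce homomorphisms again, and this is
  where entropicity of the codomain enters, twice.

  For closure, entropicity says exactly that the bracket, as a map \<open>X\<^sup>3 \<rightarrow> X\<close>,
  is a homomorphism. For divisibility, the equation \<open>[k, f, g] = h\<close> (and likewise with the
  unknown in another slot) has a unique pointwise solution \<open>k\<close>. Bracketing three instances of
  the equation \<open>[k t, f t, g t] = h t\<close> and applying entropicity shows that
  \<open>[k x, k y, k z]\<close> solves the same equation as \<open>k [x, y, z]\<close>, so the two agree.
  The three slots are treated together in \<open>ex1_hom_solution\<close>, by letting \<open>P\<close> be the
  bracket with its arguments permuted; entropicity survives as the statement that \<open>P\<close>
  commutes with the bracket.
\<close>

lemma tribracket_homI:
  assumes "\<And>t. t \<in> T \<Longrightarrow> f t \<in> X" and "f \<in> extensional T"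
    and "\<And>x y z. \<lbrakk>x \<in> T; y \<in> T; z \<in> T\<rbrakk> \<Longrightarrow> brX (f x) (f y) (f z) = f (brT x y z)"
  shows "f \<in> tribracket_hom T brT X brX"
  using assms by (auto simp: tribracket_hom_def PiE_def)

lemma tribracket_hom_in: "\<lbrakk>f \<in> tribracket_hom T brT X brX; t \<in> T\<rbrakk> \<Longrightarrow> f t \<in> X"
  by (auto simp: tribracket_hom_def)

lemma tribracket_hom_extensional: "f \<in> tribracket_hom T brT X brX \<Longrightarrow> f \<in> extensional T"
  by (auto simp: tribracket_hom_def PiE_def)

lemma tribracket_hom_bracket:
  "\<lbrakk>f \<in> tribracket_hom T brT X brX; x \<in> T; y \<in> T; z \<in> T\<rbrakk>
    \<Longrightarrow> f (brT x y z) = brX (f x) (f y) (f z)"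
  by (simp add: tribracket_hom_def)

lemma hom_bracket_apply [simp]: "t \<in> T \<Longrightarrow> hom_bracket T brX f g h t = brX (f t) (g t) (h t)"
  by (simp add: hom_bracket_def)

lemma hom_bracket_extensional [simp]: "hom_bracket T brX f g h \<in> extensional T"
  by (simp add: hom_bracket_def)

text \<open>
  The bracket of \<open>f\<close>, \<open>g\<close>, \<open>h\<close> is their joint map \<open>T \<rightarrow> X\<^sup>3\<close> followed by
  the bracket of \<open>X\<close>, and entropicity makes the latter a homomorphism.
\<close>

lemma hom_bracket_closed:
  assumes T: "tribracket T brT" and X: "entropic_tribracket X brX"
    and hom: "f \<in> tribracket_hom T brT X brX" "g \<in> tribracket_hom T brT X brX"
      "h \<in> tribracket_hom T brT X brX"
  shows "hom_bracket T brX f g h \<in> tribracket_hom T brT X brX"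
proof -
  interpret T: tribracket T brT by (rule T)
  interpret X: entropic_tribracket X brX by (rule X)
  note mem = hom[THEN tribracket_hom_in]
  show ?thesis
  proof (rule tribracket_homI)
    fix x y z assume t: "x \<in> T" "y \<in> T" "z \<in> T"
    show "brX (hom_bracket T brX f g h x) (hom_bracket T brX f g h y) (hom_bracket T brX f g h z)
      = hom_bracket T brX f g h (brT x y z)"
      using t by (simp add: T.closed hom[THEN tribracket_hom_bracket] X.entropic mem)
  qed (simp_all add: X.closed mem)
qed

text \<open>
  Uniqueness of solutions in \<open>X\<close> is used for both halves of the conclusion: it forces the
  pointwise solution to be a homomorphism, and it forces any two solutions to agree at each point.
\<close>

lemma ex1_hom_solution:
  assumes T: "tribracket T brT" and X: "tribracket X brX"
    and unique: "\<And>x y z. \<lbrakk>x \<in> X; y \<in> X; z \<in> X\<rbrakk> \<Longrightarrow> \<exists>!a. a \<in> X \<and> P a x y = z"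
    and commute: "\<And>x y z u v w a b c.
      \<lbrakk>x \<in> X; y \<in> X; z \<in> X; u \<in> X; v \<in> X; w \<in> X; a \<in> X; b \<in> X; c \<in> X\<rbrakk> \<Longrightarrow>
        P (brX x y z) (brX u v w) (brX a b c) = brX (P x u a) (P y v b) (P z w c)"
    and hom: "f \<in> tribracket_hom T brT X brX" "g \<in> tribracket_hom T brT X brX"
      "h \<in> tribracket_hom T brT X brX"
  shows "\<exists>!k. k \<in> tribracket_hom T brT X brX \<and> hom_bracket T P k f g = h"
proof -
  note mem = hom[THEN tribracket_hom_in]
  have cancel: "a = b" if "a \<in> X" "b \<in> X" "x \<in> X" "y \<in> X" "P b x y \<in> X" "P a x y = P b x y"
    for a b x y
    using unique[of x y "P b x y"] that by blast
  define k where "k = (\<lambda>t\<in>T. THE a. a \<in> X \<and> P a (f t) (g t) = h t)"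
  have k: "k t \<in> X" "P (k t) (f t) (g t) = h t" if "t \<in> T" for t
    using theI'[OF unique[OF mem], OF that that that] that by (simp_all add: k_def)
  have "k \<in> tribracket_hom T brT X brX"
  proof (rule tribracket_homI)
    fix x y z assume t: "x \<in> T" "y \<in> T" "z \<in> T"
    let ?s = "brT x y z"
    have s: "?s \<in> T" using t by (rule tribracket.closed[OF T])
    have "P (brX (k x) (k y) (k z)) (f ?s) (g ?s)
      = brX (P (k x) (f x) (g x)) (P (k y) (f y) (g y)) (P (k z) (f z) (g z))"
      using t by (simp add: hom[THEN tribracket_hom_bracket] commute k mem)
    also have "\<dots> = h ?s"
      using t by (simp add: tribracket_hom_bracket[OF hom(3)] k)
    also have "\<dots> = P (k ?s) (f ?s) (g ?s)"
      using s by (simp add: k)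
    finally show "brX (k x) (k y) (k z) = k ?s"
      using t s by - (rule cancel[of _ _ "f ?s" "g ?s"],
          simp_all add: tribracket.closed[OF X] k mem)
  qed (simp_all add: k, simp add: k_def)
  moreover have "hom_bracket T P k f g = h"
    by (rule extensionalityI[of _ T]) (simp_all add: k tribracket_hom_extensional[OF hom(3)])
  moreover have "k' = k"
    if k': "k' \<in> tribracket_hom T brT X brX" "hom_bracket T P k' f g = h" for k'
  proof (rule extensionalityI[of _ T])
    fix t assume t: "t \<in> T"
    then have "P (k' t) (f t) (g t) = h t"
      by (simp flip: k'(2))
    then show "k' t = k t"
      using t by - (rule cancel[of _ _ "f t" "g t"],
          simp_all add: k mem tribracket_hom_in[OF k'(1)])
  qed (simp_all add: k_def tribracket_hom_extensional[OF k'(1)])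
  ultimately show ?thesis by blast
qed

theorem proposition2:
  fixes T :: "'a set" and brT :: "'a \<Rightarrow> 'a \<Rightarrow> 'a \<Rightarrow> 'a"
    and X :: "'b set" and brX :: "'b \<Rightarrow> 'b \<Rightarrow> 'b \<Rightarrow> 'b"
  assumes "tribracket T brT"
    and "entropic_tribracket X brX"
    and "finite X"
  shows "entropic_tribracket (tribracket_hom T brT X brX) (hom_bracket T brX)"
proof -
  interpret X: entropic_tribracket X brX by (rule assms(2))
  note hom_closed = hom_bracket_closed[OF assms(1,2)]
  note solution = ex1_hom_solution[OF assms(1) X.tribracket_axioms]
  show ?thesis
  proof
    fix f g h
    assume hom: "f \<in> tribracket_hom T brT X brX" "g \<in> tribracket_hom T brT X brX"
      "h \<in> tribracket_hom T brT X brX"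
    show "hom_bracket T brX f g h \<in> tribracket_hom T brT X brX"
      by (rule hom_closed[OF hom])
    show "\<exists>!k. k \<in> tribracket_hom T brT X brX \<and> hom_bracket T brX k f g = h"
      by (rule solution[OF _ _ hom]) (rule X.unique_left X.entropic; assumption)+
    have "\<exists>!k. k \<in> tribracket_hom T brT X brX \<and> hom_bracket T (\<lambda>b x y. brX x b y) k f g = h"
      by (rule solution[OF _ _ hom]) (rule X.unique_middle X.entropic; assumption)+
    then show "\<exists>!k. k \<in> tribracket_hom T brT X brX \<and> hom_bracket T brX f k g = h"
      by (simp add: hom_bracket_def)
    have "\<exists>!k. k \<in> tribracket_hom T brT X brX \<and> hom_bracket T (\<lambda>c x y. brX x y c) k f g = h"
      by (rule solution[OF _ _ hom]) (rule X.unique_right X.entropic; assumption)+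
    then show "\<exists>!k. k \<in> tribracket_hom T brT X brX \<and> hom_bracket T brX f g k = h"
      by (simp add: hom_bracket_def)
  next
    fix f g h k
    assume hom: "f \<in> tribracket_hom T brT X brX" "g \<in> tribracket_hom T brT X brX"
      "h \<in> tribracket_hom T brT X brX" "k \<in> tribracket_hom T brT X brX"
    note mem = hom[THEN tribracket_hom_in]
    show "hom_bracket T brX g (hom_bracket T brX f g h) (hom_bracket T brX f g k)
      = hom_bracket T brX h (hom_bracket T brX f g h) (hom_bracket T brX f h k)"
      by (rule extensionalityI[of _ T]) (simp_all, rule X.exchange_left, simp_all add: mem)
    show "hom_bracket T brX h (hom_bracket T brX f g h) (hom_bracket T brX f h k)
      = hom_bracket T brX k (hom_bracket T brX f g k) (hom_bracket T brX f h k)"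
      by (rule extensionalityI[of _ T]) (simp_all, rule X.exchange_right, simp_all add: mem)
  next
    fix x y z u v w a b c
    assume hom: "x \<in> tribracket_hom T brT X brX" "y \<in> tribracket_hom T brT X brX"
      "z \<in> tribracket_hom T brT X brX" "u \<in> tribracket_hom T brT X brX"
      "v \<in> tribracket_hom T brT X brX" "w \<in> tribracket_hom T brT X brX"
      "a \<in> tribracket_hom T brT X brX" "b \<in> tribracket_hom T brT X brX"
      "c \<in> tribracket_hom T brT X brX"
    note mem = hom[THEN tribracket_hom_in]
    show "hom_bracket T brX (hom_bracket T brX x y z) (hom_bracket T brX u v w)
        (hom_bracket T brX a b c)
      = hom_bracket T brX (hom_bracket T brX x u a) (hom_bracket T brX y v b)
        (hom_bracket T brX z w c)"
      by (rule extensionalityI[of _ T]) (simp_all, rule X.entropic, simp_all add: mem)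
  qed
qed

end
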